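(* Let $\mathcal H$ be a complex separable Hilbert space and $T:\mathcal H\to\mathcal H$ an isometry. Suppose that $\mathcal H=\mathcal M\oplus\mathcal M^\perp$, where $T|_{\mathcal M}:\mathcal M\to\mathcal M$ is a shift (unilateral or bilateral) and $T|_{\mathcal M^\perp}:\mathcal M^\perp\to\mathcal M^\perp$ is the identity operator. Let $\mathcal V$ be a generating wandering subspace for $T|_{\mathcal M}$, and let $\Pi_{\mathcal M^\perp}$ and $\Pi_k$ be the orthogonal projections of $\mathcal H$ onto $\mathcal M^\perp$ and $T^k(\mathcal V)$ respectively, where $k$ ranges over $\mathbb N\cup\{0\}$ if $T|_{\mathcal M}$ is a unilateral shift and over $\mathbb Z$ if it is a bilateral shift. Then for every $f\in\mathcal H$ and every $N\ge1$, \[ \bigg\|\frac1N\sum_{n=0}^{N-1}T^nf-\Pi_{\mathcal M^\perp}f\bigg\|_{\mathcal H}\le\frac1{\sqrt N}\sum_k\|\Pi_kf\|_{\mathcal H}. \] Moreover, the rate of convergence $1/\sqrt N$ is sharp.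
   Context: Isometry means a bounded linear operator $T$ with $\langle Tf,Tg\rangle=\langle f,g\rangle$ for all $f,g$. Subspaces are closed. An isometry $T:\mathcal M\to\mathcal M$ is a unilateral shift if there is a subspace $\mathcal V\subseteq\mathcal M$ (a generating wandering subspace) such that $T^m(\mathcal V)\perp T^n(\mathcal V)$ for all $m\ne n$ in $\mathbb N\cup\{0\}$ and $\mathcal M=\bigoplus_{k\in\mathbb N\cup\{0\}}T^k(\mathcal V)$. A unitary operator $T:\mathcal M\to\mathcal M$ is a bilateral shift if there is a subspace $\mathcal V\subseteq\mathcal M$ (a generating wandering subspace) such that $T^m(\mathcal V)\perp T^n(\mathcal V)$ for all $m\neq n$ in $\mathbb Z$ and $\mathcal M=\bigoplus_{k\in\mathbb Z}T^k(\mathcal V)$. The sum over $k$ on the right-hand side may be $+\infty$. The paper justifies sharpness by observing that the inequality is an equality when $f=\Pi_kf$ for a single $k$. *)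

theory Defs
  imports "HOL-Analysis.Analysis"
begin

text \<open>The real inner product of the underlying real Hilbert space is the real part of the
  complex one, so norm, metric and topology are the usual ones: the norm of \<open>x\<close> is
  the square root of \<open>cinner x x\<close>. The form is linear in its first argument.\<close>

class complex_inner = real_inner +
  fixes scaleC :: "complex \<Rightarrow> 'a \<Rightarrow> 'a"  (infixr \<open>*\<^sub>C\<close> 75)
    and cinner :: "'a \<Rightarrow> 'a \<Rightarrow> complex"
  assumes scaleC_add_right: "a *\<^sub>C (x + y) = a *\<^sub>C x + a *\<^sub>C y"
    and scaleC_add_left: "(a + b) *\<^sub>C x = a *\<^sub>C x + b *\<^sub>C x"
    and scaleC_scaleC: "a *\<^sub>C b *\<^sub>C x = (a * b) *\<^sub>C x"
    and scaleC_one: "1 *\<^sub>C x = x"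
    and scaleR_scaleC: "r *\<^sub>R x = complex_of_real r *\<^sub>C x"
    and cinner_add_left: "cinner (x + y) z = cinner x z + cinner y z"
    and cinner_scaleC_left: "cinner (a *\<^sub>C x) y = a * cinner x y"
    and cinner_commute: "cinner x y = cnj (cinner y x)"
    and inner_eq_Re_cinner: "x \<bullet> y = Re (cinner x y)"

class complex_hilbert_space = complex_inner + complete_space

global_interpretation complex_vector:
  vector_space "scaleC :: complex \<Rightarrow> 'a \<Rightarrow> 'a::complex_inner"
  by unfold_locales
    (use scaleC_add_right scaleC_add_left scaleC_scaleC scaleC_one in auto)

definition closed_csubspace :: "'a::complex_inner set \<Rightarrow> bool" where
  "closed_csubspace S \<longleftrightarrow> complex_vector.subspace S \<and> closed S"

definition corthogonal_sets :: "'a::complex_inner set \<Rightarrow> 'a set \<Rightarrow> bool" where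
  "corthogonal_sets A B \<longleftrightarrow> (\<forall>x\<in>A. \<forall>y\<in>B. cinner x y = 0)"

definition corthogonal_comp :: "'a::complex_inner set \<Rightarrow> 'a set" where
  "corthogonal_comp S = {x. \<forall>y\<in>S. cinner x y = 0}"

definition corth_proj :: "'a::complex_inner set \<Rightarrow> 'a \<Rightarrow> 'a" where
  "corth_proj S f = (THE g. g \<in> S \<and> f - g \<in> corthogonal_comp S)"

text \<open>\<open>cisometry_on M T\<close> says that \<open>T\<close> restricts to an isometry from \<open>M\<close> to \<open>M\<close>.\<close>

definition cisometry_on :: "'a::complex_inner set \<Rightarrow> ('a \<Rightarrow> 'a) \<Rightarrow> bool" where
  "cisometry_on M T \<longleftrightarrow>
     T ` M \<subseteq> M \<and>
     (\<forall>x\<in>M. \<forall>y\<in>M. T (x + y) = T x + T y) \<and>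
     (\<forall>a. \<forall>x\<in>M. T (a *\<^sub>C x) = a *\<^sub>C T x) \<and>
     (\<exists>B. \<forall>x\<in>M. norm (T x) \<le> B * norm x) \<and>
     (\<forall>x\<in>M. \<forall>y\<in>M. cinner (T x) (T y) = cinner x y)"

definition cunitary_on :: "'a::complex_inner set \<Rightarrow> ('a \<Rightarrow> 'a) \<Rightarrow> bool" where
  "cunitary_on M T \<longleftrightarrow> cisometry_on M T \<and> T ` M = M"

text \<open>The integer power of the restriction of \<open>T\<close> to \<open>M\<close>. Negative exponents are used only
  when that restriction is unitary.\<close>

definition zpow_on :: "'a set \<Rightarrow> ('a \<Rightarrow> 'a) \<Rightarrow> int \<Rightarrow> 'a \<Rightarrow> 'a" where
  "zpow_on M T k = (if 0 \<le> k then T ^^ nat k else inv_into M T ^^ nat (- k))"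

text \<open>The index set \<open>K\<close> is \<open>{0..}\<close> for unilateral and \<open>UNIV\<close> for bilateral shifts. The orthogonal
  sum of the pairwise orthogonal subspaces is their closed linear span.\<close>

definition generating_wandering ::
    "int set \<Rightarrow> 'a::complex_inner set \<Rightarrow> ('a \<Rightarrow> 'a) \<Rightarrow> 'a set \<Rightarrow> bool" where
  "generating_wandering K M T V \<longleftrightarrow>
     closed_csubspace V \<and> V \<subseteq> M \<and>
     (\<forall>m\<in>K. \<forall>n\<in>K. m \<noteq> n \<longrightarrow> corthogonal_sets (zpow_on M T m ` V) (zpow_on M T n ` V)) \<and>
     M = closure (complex_vector.span (\<Union>k\<in>K. zpow_on M T k ` V))"

definition unilateral_shift_on :: "'a::complex_inner set \<Rightarrow> ('a \<Rightarrow> 'a) \<Rightarrow> bool" where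
  "unilateral_shift_on M T \<longleftrightarrow>
     cisometry_on M T \<and> (\<exists>V. generating_wandering {0..} M T V)"

definition bilateral_shift_on :: "'a::complex_inner set \<Rightarrow> ('a \<Rightarrow> 'a) \<Rightarrow> bool" where
  "bilateral_shift_on M T \<longleftrightarrow>
     cunitary_on M T \<and> (\<exists>V. generating_wandering UNIV M T V)"

definition ergodic_error :: "'a::complex_inner set \<Rightarrow> ('a \<Rightarrow> 'a) \<Rightarrow> nat \<Rightarrow> 'a \<Rightarrow> real" where
  "ergodic_error M T N f =
     norm ((1 / real N) *\<^sub>R (\<Sum>n<N. (T ^^ n) f) - corth_proj (corthogonal_comp M) f)"

text \<open>The sum of the norms of the projections onto the subspaces \<open>T\<^sup>k(V)\<close>; it may be infinite.\<close>

definition component_norm_sum ::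
    "int set \<Rightarrow> 'a::complex_inner set \<Rightarrow> ('a \<Rightarrow> 'a) \<Rightarrow> 'a set \<Rightarrow> 'a \<Rightarrow> ennreal" where
  "component_norm_sum K M T V f =
     (\<Sum>\<^sub>\<infinity>k\<in>K. ennreal (norm (corth_proj (zpow_on M T k ` V) f)))"

end

theory Submission
  imports Defs
begin

text \<open>A vector of some \<open>T\<^sup>k(V)\<close> has pairwise orthogonal iterates of equal norm, so by Pythagoras
  its \<open>N\<close>-th Cesaro mean has exactly \<open>1 / sqrt N\<close> times its norm; this gives sharpness. The vectors
  orthogonal to \<open>M\<close> are fixed by \<open>T\<close> and contribute nothing to the error. The component in \<open>M\<close>
  is approximated by finite sums of its projections, and since the Cesaro means are contractions,
  the triangle inequality gives the upper bound.\<close>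

section \<open>The complex inner product\<close>

lemma cinner_add_right: "cinner x (y + z) = cinner x y + cinner x z"
  for x y z :: "'a::complex_inner"
  by (metis cinner_add_left cinner_commute complex_cnj_add)

lemma cinner_scaleC_right: "cinner x (a *\<^sub>C y) = cnj a * cinner x y"
  for x y :: "'a::complex_inner"
  by (metis cinner_scaleC_left cinner_commute complex_cnj_mult)

lemma cinner_zero_left [simp]: "cinner 0 y = 0" for y :: "'a::complex_inner"
  using cinner_add_left[of 0 0 y] by simp

lemma cinner_zero_right [simp]: "cinner y 0 = 0" for y :: "'a::complex_inner"
  using cinner_add_right[of y 0 0] by simp

lemma cinner_diff_left: "cinner (x - y) z = cinner x z - cinner y z"
  for x y z :: "'a::complex_inner"
  using cinner_add_left[of "x - y" y z] by simp

lemma cinner_diff_right: "cinner x (y - z) = cinner x y - cinner x z"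
  for x y z :: "'a::complex_inner"
  using cinner_add_right[of x "y - z" z] by simp

lemma cinner_sum_right: "cinner x (\<Sum>i\<in>I. g i) = (\<Sum>i\<in>I. cinner x (g i))"
  for x :: "'a::complex_inner"
  by (induction I rule: infinite_finite_induct) (auto simp: cinner_add_right)

lemma cinner_sum_left: "cinner (\<Sum>i\<in>I. g i) x = (\<Sum>i\<in>I. cinner (g i) x)"
  for x :: "'a::complex_inner"
  by (induction I rule: infinite_finite_induct) (auto simp: cinner_add_left)

lemma cinner_eq_zero_sym: "cinner x y = 0 \<longleftrightarrow> cinner y x = 0"
  for x y :: "'a::complex_inner"
  by (metis cinner_commute complex_cnj_zero)

lemma cinner_eq_zero_imp_inner: "cinner x y = 0 \<Longrightarrow> x \<bullet> y = 0"
  for x y :: "'a::complex_inner"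
  by (simp add: inner_eq_Re_cinner)

lemma norm_eq_if_cinner_eq: "cinner x x = cinner y y \<Longrightarrow> norm x = norm y"
  for x :: "'a::complex_inner" and y :: "'b::complex_inner"
  by (simp add: norm_eq_sqrt_inner inner_eq_Re_cinner)

lemma csubspace_scaleR:
  "complex_vector.subspace S \<Longrightarrow> x \<in> S \<Longrightarrow> r *\<^sub>R x \<in> S"
  by (simp add: scaleR_scaleC complex_vector.subspace_scale)

lemma csubspace_corthogonal_comp: "complex_vector.subspace (corthogonal_comp S)"
  by (auto simp: complex_vector.subspace_def corthogonal_comp_def cinner_add_left
      cinner_scaleC_left)

section \<open>Orthogonal projections\<close>

text \<open>A minimising sequence is Cauchy by the parallelogram law, because convexity keeps
  midpoints in \<open>S\<close>; completeness of the space and closedness of \<open>S\<close> then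
  give the minimiser.\<close>

lemma nearest_point_exists:
  fixes f :: "'a::{real_inner, complete_space}"
  assumes conv: "convex S" and cl: "closed S" and ne: "S \<noteq> {}"
  shows "\<exists>g\<in>S. \<forall>s\<in>S. norm (f - g) \<le> norm (f - s)"
proof -
  define D where "D = (INF s\<in>S. (norm (f - s))\<^sup>2)"
  have bdd: "bdd_below ((\<lambda>s. (norm (f - s))\<^sup>2) ` S)"
    by (rule bdd_belowI2[of _ 0]) simp
  have D_le: "D \<le> (norm (f - s))\<^sup>2" if "s \<in> S" for s
    unfolding D_def using bdd that by (rule cINF_lower)
  have "\<exists>s\<in>S. (norm (f - s))\<^sup>2 < D + 1 / real (Suc n)" for n
    using cINF_less_iff[OF ne bdd, of "D + 1 / real (Suc n)"] by (simp add: D_def)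
  then obtain g where gS: "\<And>n. g n \<in> S"
    and g: "\<And>n. (norm (f - g n))\<^sup>2 < D + 1 / real (Suc n)"
    by metis
  have gap: "(norm (g m - g n))\<^sup>2 \<le> 2 / real (Suc m) + 2 / real (Suc n)" for m n
  proof -
    have "midpoint (g m) (g n) \<in> S"
      using conv gS by (meson closed_segment_subset midpoint_in_closed_segment subsetD)
    \<comment> \<open>Parallelogram identity for \<open>f - g m\<close> and \<open>f - g n\<close>.
      The midpoint term is at least \<open>4 * D\<close>, which cancels the two contributions
      \<open>2 * D\<close> of the other terms.\<close>
    moreover have "(norm (g m - g n))\<^sup>2 = 2 * (norm (f - g m))\<^sup>2 + 2 * (norm (f - g n))\<^sup>2
        - 4 * (norm (f - midpoint (g m) (g n)))\<^sup>2"
      by (simp add: midpoint_def power2_norm_eq_inner inner_diff_left inner_diff_right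
          inner_add_left inner_add_right inner_commute algebra_simps)
    moreover have "2 * (norm (f - g k))\<^sup>2 < 2 * D + 2 / real (Suc k)" for k
      using g[of k] by simp
    note this[of m] this[of n]
    ultimately show ?thesis
      using D_le[of "midpoint (g m) (g n)"] by linarith
  qed
  have "Cauchy g"
  proof (rule metric_CauchyI)
    fix e :: real
    assume "e > 0"
    \<comment> \<open>Chosen so that the gap bound, at most \<open>2 / N + 2 / N\<close>, falls
      below the square of \<open>e\<close>.\<close>
    then obtain N where N: "4 / e\<^sup>2 < real N"
      using reals_Archimedean2 by blast
    have "dist (g m) (g n) < e" if "m \<ge> N" "n \<ge> N" for m n
    proof -
      have "N > 0"
        using N \<open>e > 0\<close> by (metis divide_nonneg_nonneg gr0I less_le_not_le of_nat_0 zero_le_numeral zero_le_power2)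
      have "2 / real (Suc m) + 2 / real (Suc n) \<le> 2 / real N + 2 / real N"
        using that \<open>N > 0\<close> by (intro add_mono divide_left_mono) auto
      also have "\<dots> < e\<^sup>2"
        using N \<open>N > 0\<close> \<open>e > 0\<close> by (simp add: field_simps)
      finally have "(norm (g m - g n))\<^sup>2 < e\<^sup>2"
        using gap[of m n] by simp
      then show ?thesis
        using \<open>e > 0\<close> by (simp add: dist_norm power2_less_imp_less)
    qed
    then show "\<exists>M. \<forall>m\<ge>M. \<forall>n\<ge>M. dist (g m) (g n) < e" by blast
  qed
  then obtain l where l: "g \<longlonglongrightarrow> l"
    using Cauchy_convergent convergentD by blast
  have "(\<lambda>n. (norm (f - g n))\<^sup>2) \<longlonglongrightarrow> (norm (f - l))\<^sup>2"
    by (intro tendsto_intros l)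
  moreover have "(\<lambda>n. D + 1 / real (Suc n)) \<longlonglongrightarrow> D + 0"
    by (intro tendsto_intros LIMSEQ_Suc lim_1_over_n)
  ultimately have l_le: "(norm (f - l))\<^sup>2 \<le> D + 0"
    by (rule LIMSEQ_le) (use g less_imp_le in blast)
  have "norm (f - l) \<le> norm (f - s)" if "s \<in> S" for s
  proof (rule power2_le_imp_le)
    show "(norm (f - l))\<^sup>2 \<le> (norm (f - s))\<^sup>2"
      using l_le D_le[OF that] by linarith
  qed simp
  moreover have "l \<in> S"
    using cl gS l closed_sequentially by blast
  ultimately show ?thesis by blast
qed

lemma orthogonal_if_nearest:
  fixes h s :: "'a::real_inner"
  assumes "\<And>t::real. norm h \<le> norm (h - t *\<^sub>R s)"
  shows "h \<bullet> s = 0"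
proof (cases "s = 0")
  case False
  \<comment> \<open>The minimiser of the quadratic polynomial \<open>t\<close> maps to in the
    expansion below; a nonzero \<open>h \<bullet> s\<close> would make the norm strictly smaller
    there.\<close>
  define t where "t = (h \<bullet> s) / (s \<bullet> s)"
  have "(norm h)\<^sup>2 \<le> (norm (h - t *\<^sub>R s))\<^sup>2"
    using assms by (intro power_mono) auto
  also have "\<dots> = (norm h)\<^sup>2 - 2 * t * (h \<bullet> s) + t\<^sup>2 * (s \<bullet> s)"
    unfolding power2_norm_eq_inner
    by (simp add: inner_diff_left inner_diff_right inner_commute power2_eq_square algebra_simps)
  also have "\<dots> = (norm h)\<^sup>2 - (h \<bullet> s)\<^sup>2 / (s \<bullet> s)"
    using False unfolding t_def by (simp add: power2_eq_square field_simps)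
  finally have "(h \<bullet> s)\<^sup>2 / (s \<bullet> s) \<le> 0" by simp
  then show ?thesis
    using False by (simp add: divide_le_0_iff) (meson inner_gt_zero_iff not_le)
qed simp

text \<open>The nearest point of \<open>S\<close> serves as the projection: moving it along real
  multiples of \<open>s\<close> gives orthogonality for the real inner product, and complex scaling
  of \<open>s\<close> upgrades this to \<open>cinner\<close>.\<close>

lemma corth_proj_exists:
  fixes S :: "'a::complex_hilbert_space set"
  assumes "closed_csubspace S"
  shows "\<exists>g\<in>S. f - g \<in> corthogonal_comp S"
proof -
  have sub: "complex_vector.subspace S" and "closed S"
    using assms by (auto simp: closed_csubspace_def)
  have "convex S"
    using sub by (auto simp: convex_def csubspace_scaleR complex_vector.subspace_add)
  moreover have "S \<noteq> {}"
    using complex_vector.subspace_0[OF sub] by blast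
  ultimately obtain g where "g \<in> S" and g: "\<And>s. s \<in> S \<Longrightarrow> norm (f - g) \<le> norm (f - s)"
    using nearest_point_exists[OF _ \<open>closed S\<close>] by blast
  have re: "(f - g) \<bullet> s = 0" if "s \<in> S" for s
  proof (rule orthogonal_if_nearest)
    fix t :: real
    have "g + t *\<^sub>R s \<in> S"
      using \<open>g \<in> S\<close> that sub by (simp add: csubspace_scaleR complex_vector.subspace_add)
    from g[OF this] show "norm (f - g) \<le> norm (f - g - t *\<^sub>R s)"
      by (simp add: diff_diff_add)
  qed
  have "cinner (f - g) s = 0" if "s \<in> S" for s
  proof (rule complex_eqI)
    show "Re (cinner (f - g) s) = Re 0"
      using re[OF that] by (simp add: inner_eq_Re_cinner)
    \<comment> \<open>\<open>cinner\<close> is conjugate linear in its second argument, so the real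
      part taken at \<open>\<i> *\<^sub>C s\<close> is the imaginary part taken at
      \<open>s\<close>.\<close>
    have "(f - g) \<bullet> (\<i> *\<^sub>C s) = 0"
      using re sub that complex_vector.subspace_scale by blast
    then show "Im (cinner (f - g) s) = Im 0"
      by (simp add: inner_eq_Re_cinner cinner_scaleC_right)
  qed
  then show ?thesis
    using \<open>g \<in> S\<close> by (auto simp: corthogonal_comp_def)
qed

text \<open>Two candidates differ by a vector that lies both in \<open>S\<close> and in its
  orthogonal complement, hence is orthogonal to itself.\<close>

lemma corth_proj_eqI:
  assumes "complex_vector.subspace S" "g \<in> S" "f - g \<in> corthogonal_comp S"
  shows "corth_proj S f = g"
  unfolding corth_proj_def
proof (rule the_equality)
  fix h
  assume h: "h \<in> S \<and> f - h \<in> corthogonal_comp S"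
  have "(f - g) - (f - h) \<in> corthogonal_comp S"
    using h assms(3) complex_vector.subspace_diff[OF csubspace_corthogonal_comp] by blast
  moreover have "h - g \<in> S"
    using h assms by (intro complex_vector.subspace_diff) auto
  ultimately have "cinner (h - g) (h - g) = 0"
    by (simp add: corthogonal_comp_def)
  then show "h = g"
    using cinner_eq_zero_imp_inner[of "h - g" "h - g"] by simp
qed (use assms in auto)

lemma corth_proj_in:
  fixes S :: "'a::complex_hilbert_space set"
  assumes "closed_csubspace S"
  shows "corth_proj S f \<in> S"
    and "f - corth_proj S f \<in> corthogonal_comp S"
  using corth_proj_exists[OF assms, of f] corth_proj_eqI[of S _ f] assms
  by (auto simp: closed_csubspace_def)

section \<open>Isometries and integer powers\<close>

lemma cisometry_on_norm: "cisometry_on M T \<Longrightarrow> x \<in> M \<Longrightarrow> norm (T x) = norm x"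
  by (rule norm_eq_if_cinner_eq) (simp add: cisometry_on_def)

lemma cisometry_onI:
  assumes "T ` M \<subseteq> M"
    and "\<And>x y. x \<in> M \<Longrightarrow> y \<in> M \<Longrightarrow> T (x + y) = T x + T y"
    and "\<And>a x. x \<in> M \<Longrightarrow> T (a *\<^sub>C x) = a *\<^sub>C T x"
    and "\<And>x y. x \<in> M \<Longrightarrow> y \<in> M \<Longrightarrow> cinner (T x) (T y) = cinner x y"
  shows "cisometry_on M T"
proof -
  have "\<forall>x\<in>M. norm (T x) \<le> 1 * norm x"
    using assms(4) norm_eq_if_cinner_eq by (metis mult_1 order_refl)
  then show ?thesis
    using assms unfolding cisometry_on_def by blast
qed

lemma cisometry_on_diff:
  assumes "cisometry_on M T" "complex_vector.subspace M" "x \<in> M" "y \<in> M"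
  shows "T (x - y) = T x - T y"
proof -
  have "T ((x - y) + y) = T (x - y) + T y"
    using assms complex_vector.subspace_diff unfolding cisometry_on_def by blast
  then show ?thesis by simp
qed

lemma cisometry_on_zero: "cisometry_on M T \<Longrightarrow> 0 \<in> M \<Longrightarrow> T 0 = 0"
  using cisometry_on_norm[of M T 0] by simp

lemma cisometry_on_funpow:
  assumes T: "cisometry_on M T"
  shows "cisometry_on M (T ^^ n)"
proof (induction n)
  case 0
  show ?case by (rule cisometry_onI) auto
next
  case (Suc n)
  define S where "S = T ^^ n"
  have S: "cisometry_on M S" using Suc by (simp add: S_def)
  then have [simp]: "S x \<in> M" if "x \<in> M" for x
    using that by (auto simp: cisometry_on_def)
  have "cisometry_on M (T \<circ> S)"
    by (rule cisometry_onI) (use S T in \<open>auto simp: cisometry_on_def\<close>)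
  then show ?case by (simp only: S_def funpow.simps)
qed

lemma cisometry_on_inj_on:
  assumes "cisometry_on M T" "complex_vector.subspace M"
  shows "inj_on T M"
proof (rule inj_onI)
  fix x y
  assume "x \<in> M" "y \<in> M" "T x = T y"
  then have "norm (T (x - y)) = 0"
    using cisometry_on_diff[OF assms] by simp
  then show "x = y"
    using cisometry_on_norm[OF assms(1)] complex_vector.subspace_diff[OF assms(2)]
      \<open>x \<in> M\<close> \<open>y \<in> M\<close> by simp
qed

text \<open>Surjectivity writes every vector of \<open>M\<close> as some \<open>T a\<close>, so each
  identity for the inverse is the one for \<open>T\<close> read backwards.\<close>

lemma cisometry_on_inv_into:
  assumes "cunitary_on M T" and sub: "complex_vector.subspace M"
  shows "cisometry_on M (inv_into M T)"
proof -
  have iso: "cisometry_on M T" and surj: "T ` M = M"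
    using assms(1) by (auto simp: cunitary_on_def)
  have inv [simp]: "inv_into M T (T x) = x" if "x \<in> M" for x
    using cisometry_on_inj_on[OF iso sub] that by simp
  have lin: "T (x + y) = T x + T y" "T (a *\<^sub>C x) = a *\<^sub>C T x"
    "cinner (T x) (T y) = cinner x y" if "x \<in> M" "y \<in> M" for a x y
    using iso that by (auto simp: cisometry_on_def)
  show ?thesis
  proof (rule cisometry_onI)
    show "inv_into M T ` M \<subseteq> M"
      using surj by (metis image_subsetI inv_into_into)
  next
    fix x y
    assume "x \<in> M" "y \<in> M"
    then obtain a b where ab: "a \<in> M" "b \<in> M" "x = T a" "y = T b"
      using surj by (metis imageE)
    have "inv_into M T (T (a + b)) = a + b"
      by (rule inv[OF complex_vector.subspace_add[OF sub ab(1,2)]])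
    with ab lin show "inv_into M T (x + y) = inv_into M T x + inv_into M T y"
      by simp
    show "cinner (inv_into M T x) (inv_into M T y) = cinner x y"
      using ab lin by simp
  next
    fix c x
    assume "x \<in> M"
    then obtain a where a: "a \<in> M" "x = T a"
      using surj by (metis imageE)
    have "inv_into M T (T (c *\<^sub>C a)) = c *\<^sub>C a"
      by (rule inv[OF complex_vector.subspace_scale[OF sub a(1)]])
    with a lin[of a a] show "inv_into M T (c *\<^sub>C x) = c *\<^sub>C inv_into M T x"
      by simp
  qed
qed

text \<open>\<open>T\<close> preserves distances on \<open>V\<close>, so a Cauchy sequence in the
  image pulls back to one in \<open>V\<close>, and the image of its limit is the required limit. In
  a complete space, complete and closed sets coincide.\<close>

lemma cisometry_on_image_closed_csubspace:
  fixes M :: "'a::complex_hilbert_space set"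
  assumes iso: "cisometry_on M T" and M: "complex_vector.subspace M"
    and V: "closed_csubspace V" "V \<subseteq> M"
  shows "closed_csubspace (T ` V)"
proof -
  have sub: "complex_vector.subspace V" and "complete V"
    using V by (auto simp: closed_csubspace_def complete_eq_closed)
  have dist: "dist (T x) (T y) = dist x y" if "x \<in> V" "y \<in> V" for x y
  proof -
    have "x \<in> M" "y \<in> M"
      using that V by auto
    then show ?thesis
      using cisometry_on_norm[OF iso complex_vector.subspace_diff[OF M]]
      by (simp add: dist_norm cisometry_on_diff[OF iso M, symmetric])
  qed
  have "complete (T ` V)"
  proof (rule completeI)
    fix s
    assume "\<forall>n. s n \<in> T ` V" and C: "Cauchy s"
    then have "\<forall>n. \<exists>v\<in>V. s n = T v" by blast
    then obtain r where r: "\<And>n. r n \<in> V" "\<And>n. s n = T (r n)"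
      by metis
    have "Cauchy r"
      using C r by (simp add: Cauchy_def dist)
    then obtain l where l: "l \<in> V" "r \<longlonglongrightarrow> l"
      using \<open>complete V\<close> r(1) unfolding complete_def by blast
    then have "s \<longlonglongrightarrow> T l"
      using r by (simp add: lim_sequentially dist)
    then show "\<exists>l\<in>T ` V. s \<longlonglongrightarrow> l"
      using l by blast
  qed
  moreover have "complex_vector.subspace (T ` V)"
    unfolding complex_vector.subspace_def
  proof (intro conjI ballI allI)
    have "0 \<in> V" "0 \<in> M"
      using sub M complex_vector.subspace_0 by blast+
    then show "0 \<in> T ` V"
      using cisometry_on_zero[OF iso] by (metis imageI)
  next
    fix x y
    assume "x \<in> T ` V" "y \<in> T ` V"
    then obtain a b where ab: "a \<in> V" "b \<in> V" "x = T a" "y = T b" by blast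
    moreover have "a \<in> M" "b \<in> M"
      using ab V(2) by blast+
    ultimately have "x + y = T (a + b)"
      using iso by (simp add: cisometry_on_def)
    then show "x + y \<in> T ` V"
      using ab sub complex_vector.subspace_add by blast
  next
    fix c x
    assume "x \<in> T ` V"
    then obtain a where a: "a \<in> V" "x = T a" by blast
    moreover have "a \<in> M"
      using a V(2) by blast
    ultimately have "c *\<^sub>C x = T (c *\<^sub>C a)"
      using iso by (simp add: cisometry_on_def)
    then show "c *\<^sub>C x \<in> T ` V"
      using a sub complex_vector.subspace_scale by blast
  qed
  ultimately show ?thesis
    by (simp add: closed_csubspace_def complete_eq_closed)
qed

text \<open>For negative \<open>k\<close> one application of \<open>T\<close> cancels the outermost
  inverse, which is where surjectivity on \<open>M\<close> enters.\<close>

lemma zpow_on_Suc: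
  assumes "0 \<le> k \<or> T ` M = M" and "x \<in> M"
  shows "T (zpow_on M T k x) = zpow_on M T (k + 1) x"
proof (cases "0 \<le> k")
  case True
  then show ?thesis
    by (simp add: zpow_on_def nat_add_distrib)
next
  case False
  then have surj: "T ` M = M" using assms(1) by blast
  define n where "n = nat (- k - 1)"
  have k: "nat (- k) = Suc n" and k1: "nat (- (k + 1)) = n"
    using False by (auto simp: n_def)
  have "(inv_into M T ^^ n) x \<in> M"
    using assms(2) surj by (induction n) (auto intro: inv_into_into)
  then have "T (zpow_on M T k x) = (inv_into M T ^^ n) x"
    using False surj k by (simp add: zpow_on_def f_inv_into_f)
  moreover have "zpow_on M T (k + 1) x = (inv_into M T ^^ n) x"
  \<comment> \<open>Here \<open>k + 1\<close> crosses into the nonnegative branch of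
    \<open>zpow_on\<close>; with \<open>n = 0\<close> both sides are \<open>x\<close>.\<close>
  proof (cases "k = - 1")
    case True
    then show ?thesis by (simp add: zpow_on_def n_def)
  next
    case False
    with \<open>\<not> 0 \<le> k\<close> show ?thesis
      using k1 by (simp add: zpow_on_def)
  qed
  ultimately show ?thesis by simp
qed

lemma zpow_on_funpow:
  assumes "0 \<le> k \<or> T ` M = M" and "x \<in> M"
  shows "(T ^^ n) (zpow_on M T k x) = zpow_on M T (k + int n) x"
proof (induction n)
  case (Suc n)
  have "0 \<le> k + int n \<or> T ` M = M" using assms(1) by auto
  from zpow_on_Suc[OF this assms(2)] Suc show ?case
    by (simp add: algebra_simps)
qed simp

lemma cisometry_on_zpow_on:
  assumes "complex_vector.subspace M"
    and "cisometry_on M T \<and> 0 \<le> k \<or> cunitary_on M T"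
  shows "cisometry_on M (zpow_on M T k)"
  using assms cisometry_on_funpow[of M T] cisometry_on_funpow[OF cisometry_on_inv_into, of M T]
  by (auto simp: zpow_on_def cunitary_on_def)

section \<open>Cesaro means\<close>

text \<open>The averaging part of \<open>ergodic_error\<close>, isolated for its additivity and
  contractivity. At \<open>N = 0\<close> the convention for division by zero makes it the zero
  vector.\<close>

definition cesaro_mean :: "('a::real_vector \<Rightarrow> 'a) \<Rightarrow> nat \<Rightarrow> 'a \<Rightarrow> 'a" where
  "cesaro_mean T N f = (1 / real N) *\<^sub>R (\<Sum>n<N. (T ^^ n) f)"

lemma cesaro_mean_add:
  assumes "cisometry_on UNIV T"
  shows "cesaro_mean T N (x + y) = cesaro_mean T N x + cesaro_mean T N y"
proof -
  have "(T ^^ n) (x + y) = (T ^^ n) x + (T ^^ n) y" for n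
    using cisometry_on_funpow[OF assms, of n] by (auto simp: cisometry_on_def)
  then show ?thesis
    by (simp add: cesaro_mean_def sum.distrib scaleR_add_right)
qed

lemma cesaro_mean_sum:
  assumes "cisometry_on UNIV T"
  shows "cesaro_mean T N (\<Sum>i\<in>I. g i) = (\<Sum>i\<in>I. cesaro_mean T N (g i))"
proof -
  have "cesaro_mean T N 0 = 0"
    using cesaro_mean_add[OF assms, of N 0 0] by simp
  then show ?thesis
    by (induction I rule: infinite_finite_induct) (auto simp: cesaro_mean_add[OF assms])
qed

lemma norm_cesaro_mean_le:
  assumes "cisometry_on UNIV T"
  shows "norm (cesaro_mean T N x) \<le> norm x"
proof (cases "N = 0")
  case False
  have "norm (\<Sum>n<N. (T ^^ n) x) \<le> (\<Sum>n<N. norm x)"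
    by (rule sum_norm_le) (simp add: cisometry_on_norm[OF cisometry_on_funpow[OF assms]])
  then show ?thesis
    using False by (simp add: cesaro_mean_def field_simps)
qed (simp add: cesaro_mean_def)

lemma cesaro_mean_fixed_point:
  assumes "T x = x" "N \<ge> 1"
  shows "cesaro_mean T N x = x"
proof -
  have "(T ^^ n) x = x" for n
    using assms(1) by (induction n) auto
  then show ?thesis
    using assms(2) by (simp add: cesaro_mean_def sum_constant_scaleR)
qed

text \<open>Source of the rate: by Pythagoras the orbit sum has norm \<open>sqrt N * norm x\<close>,
  and dividing by \<open>N\<close> leaves \<open>1 / sqrt N\<close>. At \<open>N = 0\<close> both
  sides are zero by convention.\<close>

lemma norm_cesaro_mean_orthogonal_orbit:
  assumes "cisometry_on UNIV T"
    and orth: "\<And>m n. m \<noteq> n \<Longrightarrow> cinner ((T ^^ m) x) ((T ^^ n) x) = 0"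
  shows "norm (cesaro_mean T N x) = norm x / sqrt (real N)"
proof (cases "N = 0")
  case False
  have "(norm (\<Sum>n<N. (T ^^ n) x))\<^sup>2 = (\<Sum>n<N. (norm ((T ^^ n) x))\<^sup>2)"
    by (rule norm_sum_Pythagorean)
      (auto simp: pairwise_def orthogonal_def intro: cinner_eq_zero_imp_inner orth)
  also have "\<dots> = real N * (norm x)\<^sup>2"
    by (simp add: cisometry_on_norm[OF cisometry_on_funpow[OF assms(1)]])
  finally have "norm (\<Sum>n<N. (T ^^ n) x) = sqrt (real N) * norm x"
    by (metis norm_ge_zero real_sqrt_abs abs_norm_cancel real_sqrt_mult)
  then show ?thesis
    using False by (simp add: cesaro_mean_def field_simps)
qed (simp add: cesaro_mean_def)

section \<open>Decomposition along a generating wandering subspace\<close>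

text \<open>\<open>shift\<close> couples the index set to the kind of restriction, isometric for
  \<open>{0..}\<close> and unitary for \<open>UNIV\<close>; the generating wandering subspace is the
  parameter \<open>V\<close> itself.\<close>

locale wandering_decomposition =
  fixes T :: "'a::complex_hilbert_space \<Rightarrow> 'a" and M V :: "'a set" and K :: "int set"
  assumes isometry: "cisometry_on UNIV T"
    and closed_M: "closed_csubspace M"
    and shift: "cisometry_on M T \<and> K = {0..} \<or> cunitary_on M T \<and> K = UNIV"
    and fixed: "\<forall>f\<in>corthogonal_comp M. T f = f"
    and wandering: "generating_wandering K M T V"
begin

abbreviation W :: "int \<Rightarrow> 'a set" where "W k \<equiv> zpow_on M T k ` V"

lemma subspace_M: "complex_vector.subspace M"
  using closed_M by (simp add: closed_csubspace_def)

lemma V_subset: "V \<subseteq> M"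
  using wandering by (simp add: generating_wandering_def)

lemma zpow_isometry: "k \<in> K \<Longrightarrow> cisometry_on M (zpow_on M T k)"
  using shift subspace_M by (intro cisometry_on_zpow_on) auto

lemma W_subset: "k \<in> K \<Longrightarrow> W k \<subseteq> M"
  using zpow_isometry[of k] V_subset by (auto simp: cisometry_on_def)

lemma closed_W: "k \<in> K \<Longrightarrow> closed_csubspace (W k)"
  using cisometry_on_image_closed_csubspace[OF zpow_isometry subspace_M _ V_subset] wandering
  by (simp add: generating_wandering_def)

lemma subspace_W: "k \<in> K \<Longrightarrow> complex_vector.subspace (W k)"
  using closed_W by (simp add: closed_csubspace_def)

lemma W_orthogonal:
  "\<lbrakk>j \<in> K; k \<in> K; j \<noteq> k; x \<in> W j; y \<in> W k\<rbrakk> \<Longrightarrow> cinner x y = 0"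
  using wandering unfolding generating_wandering_def corthogonal_sets_def by blast

text \<open>The iterate \<open>T ^^ l\<close> carries \<open>W k\<close> into
  \<open>W (k + l)\<close>, and both possible index sets are closed under adding naturals, so the
  orbit visits pairwise orthogonal components.\<close>

lemma norm_cesaro_mean_W:
  assumes k: "k \<in> K" and x: "x \<in> W k"
  shows "norm (cesaro_mean T N x) = norm x / sqrt (real N)"
proof (rule norm_cesaro_mean_orthogonal_orbit[OF isometry])
  fix m n :: nat
  assume "m \<noteq> n"
  obtain v where v: "v \<in> V" "x = zpow_on M T k v"
    using x by blast
  have "0 \<le> k \<or> T ` M = M"
    using k shift by (auto simp: cunitary_on_def)
  then have in_W: "(T ^^ l) x \<in> W (k + int l)" for l
    using v V_subset zpow_on_funpow[of k T M v l] by auto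
  have in_K: "k + int l \<in> K" for l
    using k shift by auto
  show "cinner ((T ^^ m) x) ((T ^^ n) x) = 0"
    using \<open>m \<noteq> n\<close> by (intro W_orthogonal[OF in_K in_K _ in_W in_W]) auto
qed

text \<open>\<open>T\<close> fixes \<open>p\<close>, so its mean is \<open>p\<close> again, and this
  is exactly the projection that the error subtracts.\<close>

lemma ergodic_error_eq:
  assumes m: "m \<in> M" and p: "p \<in> corthogonal_comp M" and N: "N \<ge> 1"
  shows "ergodic_error M T N (m + p) = norm (cesaro_mean T N m)"
proof -
  \<comment> \<open>This makes \<open>m\<close> the residue of projecting \<open>m + p\<close> onto
    the complement of \<open>M\<close>.\<close>
  have "m \<in> corthogonal_comp (corthogonal_comp M)"
    using m cinner_eq_zero_sym by (auto simp: corthogonal_comp_def)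
  then have "corth_proj (corthogonal_comp M) (m + p) = p"
    using p by (intro corth_proj_eqI csubspace_corthogonal_comp) auto
  moreover have "cesaro_mean T N (m + p) = cesaro_mean T N m + p"
    using p fixed N by (simp add: cesaro_mean_add[OF isometry] cesaro_mean_fixed_point)
  ultimately show ?thesis
    by (simp add: ergodic_error_def cesaro_mean_def)
qed

text \<open>Since \<open>W k\<close> lies inside \<open>M\<close>, it is orthogonal to
  \<open>p\<close>. Thus the component sum of a vector only sees its part in
  \<open>M\<close>.\<close>

lemma corth_proj_W_add:
  assumes k: "k \<in> K" and p: "p \<in> corthogonal_comp M"
  shows "corth_proj (W k) (m + p) = corth_proj (W k) m"
proof (rule corth_proj_eqI[OF subspace_W[OF k] corth_proj_in(1)[OF closed_W[OF k]]])
  have "p \<in> corthogonal_comp (W k)"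
    using p W_subset[OF k] by (auto simp: corthogonal_comp_def)
  moreover have "m + p - corth_proj (W k) m = (m - corth_proj (W k) m) + p"
    by simp
  ultimately show "m + p - corth_proj (W k) m \<in> corthogonal_comp (W k)"
    using corth_proj_in(2)[OF closed_W[OF k], of m] csubspace_corthogonal_comp
    by (metis complex_vector.subspace_add)
qed

text \<open>A span element involves only finitely many of the \<open>W k\<close>; this is recorded through
  the vectors orthogonal to it, which avoids choosing components.\<close>

lemma span_W_orthogonal:
  assumes "x \<in> complex_vector.span (\<Union>k\<in>K. W k)"
  shows "\<exists>F. finite F \<and> F \<subseteq> K \<and>
    (\<forall>y. (\<forall>k\<in>F. y \<in> corthogonal_comp (W k)) \<longrightarrow> cinner y x = 0)"
  using assms
proof (induction rule: complex_vector.span_induct_alt)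
  case base
  show ?case by (rule exI[of _ "{}"]) simp
next
  case (step c x z)
  from step.hyps obtain j where "j \<in> K" "x \<in> W j"
    by blast
  from step.IH obtain F where F: "finite F" "F \<subseteq> K"
    "\<forall>y. (\<forall>k\<in>F. y \<in> corthogonal_comp (W k)) \<longrightarrow> cinner y z = 0"
    by (elim exE conjE)
  have "cinner y (c *\<^sub>C x + z) = 0"
    if "\<forall>k\<in>insert j F. y \<in> corthogonal_comp (W k)" for y
  proof -
    have "cinner y x = 0"
      using that \<open>x \<in> W j\<close> by (auto simp: corthogonal_comp_def)
    moreover have "cinner y z = 0"
      using that F(3) by simp
    ultimately show ?thesis
      by (simp add: cinner_add_right cinner_scaleC_right)
  qed
  then show ?case
    using F(1,2) \<open>j \<in> K\<close> by (intro exI[of _ "insert j F"]) auto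
qed

text \<open>Projecting onto finitely many components is a best approximation: the residue is
  orthogonal to a nearby span element \<open>x\<close> once \<open>F\<close> covers the components
  of \<open>x\<close>, so it is no longer than \<open>m - x\<close>.\<close>

lemma finite_sum_projections_approx:
  assumes "m \<in> M" "e > 0"
  shows "\<exists>F. finite F \<and> F \<subseteq> K \<and> norm (m - (\<Sum>k\<in>F. corth_proj (W k) m)) < e"
proof -
  have "m \<in> closure (complex_vector.span (\<Union>k\<in>K. W k))"
    using assms(1) wandering by (simp add: generating_wandering_def)
  then obtain x where x: "x \<in> complex_vector.span (\<Union>k\<in>K. W k)" "dist x m < e"
    using assms(2) closure_approachable by metis
  from span_W_orthogonal[OF x(1)] obtain F where F: "finite F" "F \<subseteq> K"
    and orth: "\<forall>y. (\<forall>k\<in>F. y \<in> corthogonal_comp (W k)) \<longrightarrow> cinner y x = 0"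
    by (elim exE conjE)
  define P where "P k = corth_proj (W k) m" for k
  define r where "r = m - (\<Sum>k\<in>F. P k)"
  have P: "P k \<in> W k" "m - P k \<in> corthogonal_comp (W k)" if "k \<in> K" for k
    unfolding P_def by (rule corth_proj_in[OF closed_W[OF that]])+
  have r_orth: "r \<in> corthogonal_comp (W k)" if "k \<in> F" for k
  proof -
    have "cinner r w = 0" if "w \<in> W k" for w
    proof -
      \<comment> \<open>Subtracting \<open>P k\<close> already makes the vector orthogonal to
        \<open>W k\<close>; the remaining terms lie in components orthogonal to it.\<close>
      have "r = (m - P k) - (\<Sum>j\<in>F - {k}. P j)"
        by (simp add: r_def sum.remove[OF F(1) \<open>k \<in> F\<close>])
      moreover have "cinner (m - P k) w = 0"
        using P(2) F(2) \<open>k \<in> F\<close> \<open>w \<in> W k\<close> by (auto simp: corthogonal_comp_def)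
      moreover have "(\<Sum>j\<in>F - {k}. cinner (P j) w) = 0"
      proof (rule sum.neutral, rule ballI)
        fix j
        assume "j \<in> F - {k}"
        then show "cinner (P j) w = 0"
          using F(2) \<open>k \<in> F\<close> \<open>w \<in> W k\<close> P(1)[of j] by (intro W_orthogonal[of j k]) auto
      qed
      ultimately show ?thesis
        by (simp add: cinner_diff_left cinner_sum_left)
    qed
    then show ?thesis
      by (simp add: corthogonal_comp_def)
  qed
  have "cinner r x = 0"
    using orth r_orth by simp
  moreover have "cinner r (\<Sum>k\<in>F. P k) = 0"
    unfolding cinner_sum_right
  proof (rule sum.neutral, rule ballI)
    fix k
    assume "k \<in> F"
    then have "P k \<in> W k"
      using P(1) F(2) by blast
    then show "cinner r (P k) = 0"
      using r_orth[OF \<open>k \<in> F\<close>] unfolding corthogonal_comp_def by blast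
  qed
  \<comment> \<open>Both \<open>x\<close> and \<open>m - r\<close> are orthogonal to
    \<open>r\<close>; Cauchy-Schwarz then bounds \<open>norm r\<close> by
    \<open>norm (m - x)\<close>.\<close>
  ultimately have "cinner r (m - x) = cinner r r"
    by (simp add: r_def cinner_diff_right)
  then have "norm r * norm r = r \<bullet> (m - x)"
    unfolding power2_eq_square[symmetric] power2_norm_eq_inner by (simp add: inner_eq_Re_cinner)
  also have "\<dots> \<le> norm r * norm (m - x)"
    by (rule norm_cauchy_schwarz)
  finally have "norm r \<le> norm (m - x)"
    by (metis mult_le_cancel_left_pos norm_ge_zero norm_le_zero_iff not_le order_trans)
  then have "norm r < e"
    using x(2) by (simp add: dist_norm norm_minus_commute)
  then show ?thesis
    using F unfolding r_def P_def by blast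
qed

section \<open>Upper bound for the ergodic error\<close>

text \<open>Working up to \<open>e\<close> needs only finite sums of projections: each summand obeys
  the exact norm formula, and the remainder costs less than \<open>e\<close> because Cesaro means
  are contractions. This also covers an infinite right-hand side.\<close>

lemma ergodic_error_le:
  assumes N: "N \<ge> 1"
  shows "ennreal (ergodic_error M T N f)
    \<le> ennreal (1 / sqrt (real N)) * component_norm_sum K M T V f"
proof (rule ennreal_le_epsilon)
  fix e :: real
  assume "e > 0"
  define m where "m = corth_proj M f"
  have m: "m \<in> M" and p: "f - m \<in> corthogonal_comp M"
    using corth_proj_in[OF closed_M] by (auto simp: m_def)
  define P where "P k = corth_proj (W k) m" for k
  have P_f: "corth_proj (W k) f = P k" if "k \<in> K" for k
    using corth_proj_W_add[OF that p, of m] by (simp add: P_def)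
  obtain F where F: "finite F" "F \<subseteq> K" and small: "norm (m - (\<Sum>k\<in>F. P k)) < e"
    using finite_sum_projections_approx[OF m \<open>e > 0\<close>] unfolding P_def by blast
  define r where "r = m - (\<Sum>k\<in>F. P k)"
  have m_eq: "m = (\<Sum>k\<in>F. P k) + r"
    by (simp add: r_def)
  have "ergodic_error M T N f = norm (cesaro_mean T N m)"
    using ergodic_error_eq[OF m p N] by simp
  also have "\<dots> = norm ((\<Sum>k\<in>F. cesaro_mean T N (P k)) + cesaro_mean T N r)"
    by (subst m_eq) (simp add: cesaro_mean_add[OF isometry] cesaro_mean_sum[OF isometry])
  also have "\<dots> \<le> (\<Sum>k\<in>F. norm (cesaro_mean T N (P k))) + norm r"
    by (intro order_trans[OF norm_triangle_ineq] add_mono norm_sum norm_cesaro_mean_le isometry)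
  also have "(\<Sum>k\<in>F. norm (cesaro_mean T N (P k))) = (\<Sum>k\<in>F. norm (P k) / sqrt (real N))"
  proof (rule sum.cong)
    fix k
    assume "k \<in> F"
    then have "k \<in> K" using F(2) by blast
    then show "norm (cesaro_mean T N (P k)) = norm (P k) / sqrt (real N)"
      unfolding P_def by (intro norm_cesaro_mean_W[of k] corth_proj_in(1) closed_W)
  qed simp
  also have "\<dots> + norm r \<le> 1 / sqrt (real N) * (\<Sum>k\<in>F. norm (P k)) + e"
    using small by (simp add: r_def sum_divide_distrib)
  finally have "ennreal (ergodic_error M T N f)
      \<le> ennreal (1 / sqrt (real N) * (\<Sum>k\<in>F. norm (P k)) + e)"
    by (rule ennreal_leI)
  also have "\<dots> = ennreal (1 / sqrt (real N)) * (\<Sum>k\<in>F. ennreal (norm (P k))) + ennreal e"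
    using \<open>e > 0\<close>
    by (simp add: ennreal_plus sum_nonneg sum_ennreal flip: ennreal_mult)
  also have "(\<Sum>k\<in>F. ennreal (norm (P k))) \<le> component_norm_sum K M T V f"
  proof -
    have "(\<Sum>k\<in>F. ennreal (norm (P k))) = (\<Sum>k\<in>F. ennreal (norm (corth_proj (W k) f)))"
      using F(2) P_f by (intro sum.cong) auto
    also have "\<dots> \<le> component_norm_sum K M T V f"
      unfolding component_norm_sum_def
      \<comment> \<open>In \<open>ennreal\<close> the infinite sum is the supremum of its finite
        partial sums.\<close>
      by (subst nonneg_infsum_complete) (use F in \<open>auto intro: SUP_upper\<close>)
    finally show ?thesis .
  qed
  finally show "ennreal (ergodic_error M T N f)
      \<le> ennreal (1 / sqrt (real N)) * component_norm_sum K M T V f + ennreal e"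
    by (simp add: add_mono mult_left_mono)
qed

section \<open>Equality on single components\<close>

text \<open>Orthogonality kills every projection except the one onto \<open>W k\<close>, which fixes
  \<open>f\<close>, so the sum collapses to one term.\<close>

lemma component_norm_sum_W:
  assumes k: "k \<in> K" and f: "f \<in> W k"
  shows "component_norm_sum K M T V f = ennreal (norm f)"
proof -
  have 1: "corth_proj (W k) f = f"
    using f by (intro corth_proj_eqI subspace_W k) (simp_all add: corthogonal_comp_def)
  have 0: "corth_proj (W j) f = 0" if "j \<in> K" "j \<noteq> k" for j
    using that W_orthogonal[OF k that(1) _ f] complex_vector.subspace_0[OF subspace_W[OF that(1)]]
    by (intro corth_proj_eqI subspace_W) (auto simp: corthogonal_comp_def)
  have "component_norm_sum K M T V f = (\<Sum>\<^sub>\<infinity>j\<in>{k}. ennreal (norm f))"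
    unfolding component_norm_sum_def
    by (rule infsum_cong_neutral) (use k 0 1 in auto)
  then show ?thesis by simp
qed

lemma ergodic_error_W:
  assumes k: "k \<in> K" and f: "f \<in> W k" and N: "N \<ge> 1"
  shows "ennreal (ergodic_error M T N f)
    = ennreal (1 / sqrt (real N)) * component_norm_sum K M T V f"
proof -
  have "ergodic_error M T N f = norm f / sqrt (real N)"
    using ergodic_error_eq[of f 0 N] W_subset[OF k] f N norm_cesaro_mean_W[OF k f]
      complex_vector.subspace_0[OF csubspace_corthogonal_comp] by auto
  then show ?thesis
    by (simp add: component_norm_sum_W[OF k f] flip: ennreal_mult)
qed

text \<open>Supplies the witness for sharpness: a zero \<open>V\<close> makes every component zero,
  and the closed span of the components is \<open>M\<close>.\<close>

lemma wandering_nontrivial: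
  assumes "M \<noteq> {0}"
  shows "\<exists>v\<in>V. v \<noteq> 0"
proof (rule ccontr)
  assume "\<not> ?thesis"
  then have V0: "V \<subseteq> {0}" by blast
  have "0 \<in> M"
    using complex_vector.subspace_0[OF subspace_M] .
  have "(\<Union>k\<in>K. W k) \<subseteq> {0}"
    using V0 cisometry_on_zero[OF zpow_isometry \<open>0 \<in> M\<close>] by auto
  then have "complex_vector.span (\<Union>k\<in>K. W k) = {0}"
    by (metis complex_vector.span_empty complex_vector.span_insert_0 complex_vector.span_mono
        complex_vector.span_zero empty_subsetI insert_subset subset_antisym)
  then have "M = {0}"
    using wandering by (simp add: generating_wandering_def)
  then show False using assms by blast
qed

end

text \<open>The last conjunct keeps sharpness from being vacuous: a single vector with nonzero
  finite component sum attains equality for all \<open>N\<close> at once. For \<open>M = {0}\<close>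
  every component sum vanishes.\<close>

theorem theorem1p2:
  fixes T :: "'a::complex_hilbert_space \<Rightarrow> 'a"
    and M V :: "'a set"
    and K :: "int set"
  assumes "separable_space (euclidean :: 'a topology)"
    and "cisometry_on UNIV T"
    and "closed_csubspace M"
    and "unilateral_shift_on M T \<and> K = {0..} \<or> bilateral_shift_on M T \<and> K = UNIV"
    and "\<forall>f\<in>corthogonal_comp M. T f = f"
    and "generating_wandering K M T V"
  shows "(\<forall>f. \<forall>N\<ge>1. ennreal (ergodic_error M T N f)
            \<le> ennreal (1 / sqrt (real N)) * component_norm_sum K M T V f) \<and>
         (\<forall>k\<in>K. \<forall>f. f = corth_proj (zpow_on M T k ` V) f \<longrightarrow>
            (\<forall>N\<ge>1. ennreal (ergodic_error M T N f)
               = ennreal (1 / sqrt (real N)) * component_norm_sum K M T V f)) \<and>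
         (M \<noteq> {0} \<longrightarrow>
            (\<exists>f. 0 < component_norm_sum K M T V f \<and> component_norm_sum K M T V f < \<infinity> \<and>
               (\<forall>N\<ge>1. ennreal (ergodic_error M T N f)
                  = ennreal (1 / sqrt (real N)) * component_norm_sum K M T V f)))"
proof -
  interpret wandering_decomposition T M V K
    using assms by unfold_locales (auto simp: unilateral_shift_on_def bilateral_shift_on_def)
  \<comment> \<open>A vector equal to its own projection onto \<open>W k\<close> lies in
    \<open>W k\<close>.\<close>
  have sharp: "ennreal (ergodic_error M T N f)
      = ennreal (1 / sqrt (real N)) * component_norm_sum K M T V f"
    if "k \<in> K" "f = corth_proj (W k) f" "N \<ge> 1" for k f N
    using ergodic_error_W[of k f N] corth_proj_in(1)[OF closed_W, of k f] that by simp
  have attained: "\<exists>f. 0 < component_norm_sum K M T V f \<and> component_norm_sum K M T V f < \<infinity> \<and>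
      (\<forall>N\<ge>1. ennreal (ergodic_error M T N f)
        = ennreal (1 / sqrt (real N)) * component_norm_sum K M T V f)"
    if "M \<noteq> {0}"
  proof -
    from wandering_nontrivial[OF that] obtain v where v: "v \<in> V" "v \<noteq> 0"
      by blast
    \<comment> \<open>The exponent 0 belongs to both index sets, and \<open>W 0\<close> is
      \<open>V\<close>; the component sum of \<open>v\<close> is then \<open>norm v\<close>,
      positive and finite.\<close>
    have "0 \<in> K" "v \<in> W 0"
      using shift v(1) by (auto simp: zpow_on_def)
    then show ?thesis
      using v(2) by (intro exI[of _ v]) (simp add: component_norm_sum_W ergodic_error_W)
  qed
  show ?thesis
    using ergodic_error_le sharp attained by blast
qed

end
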